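(* A (non-degenerate) projective plane $P$ is open if and only if $P$ is HF-constructible over $\emptyset$.
   Context: A partial plane is a system of points and lines with an incidence relation such that any two distinct points are incident with at most one common line and any two distinct lines are incident with at most one common point. A projective plane is a partial plane in which "at most one" is replaced by "exactly one" in both conditions; all projective planes are assumed non-degenerate, i.e. to contain four points no three of which are collinear. A subconfiguration is a subset with induced incidence. A partial plane $P$ is open if there is no finite subconfiguration $A$ of $P$ such that every element of $A$ is incident with at least three elements of $A$. For partial planes $A\subseteq B$ ($A$ a subconfiguration, possibly empty), $B$ is HF-constructible over $A$ if there is a linear ordering $<$ of $B-A$ (not required to be a well-ordering) such that for every $b\in B-A$ there are at most two elements of $B$ that are incident with $b$ and that either lie in $A$ or lie in $B-A$ and are $<$-smaller than $b$. Such an ordering is called an HF-ordering of $B$ over $A$. *)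

theory Defs
  imports Main
begin

record ('p, 'l) configuration =
  points :: "'p set"
  lines :: "'l set"
  inc :: "('p \<times> 'l) set"

text \<open>
  Points and lines are the elements of a configuration; they are kept apart by the sum type, so
  that incidence becomes a symmetric relation on elements.
\<close>

definition elements :: "('p, 'l) configuration \<Rightarrow> ('p + 'l) set" where
  "elements P = points P <+> lines P"

definition incident :: "('p, 'l) configuration \<Rightarrow> 'p + 'l \<Rightarrow> 'p + 'l \<Rightarrow> bool" where
  "incident P x y \<longleftrightarrow>
     (\<exists>(p, l) \<in> inc P. (x = Inl p \<and> y = Inr l) \<or> (x = Inr l \<and> y = Inl p))"

definition subconfiguration :: "('p, 'l) configuration \<Rightarrow> ('p, 'l) configuration \<Rightarrow> bool" where
  "subconfiguration A B \<longleftrightarrow>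
     points A \<subseteq> points B \<and> lines A \<subseteq> lines B \<and> inc A = inc B \<inter> (points A \<times> lines A)"

definition empty_configuration :: "('p, 'l) configuration" where
  "empty_configuration = \<lparr>points = {}, lines = {}, inc = {}\<rparr>"

definition collinear :: "('p, 'l) configuration \<Rightarrow> 'p set \<Rightarrow> bool" where
  "collinear P S \<longleftrightarrow> (\<exists>l \<in> lines P. \<forall>p \<in> S. (p, l) \<in> inc P)"

locale partial_plane =
  fixes P :: "('p, 'l) configuration"
  assumes inc_subset: "inc P \<subseteq> points P \<times> lines P"
    and at_most_one_line:
      "\<lbrakk>p \<in> points P; q \<in> points P; p \<noteq> q\<rbrakk> \<Longrightarrow>
         \<exists>\<^sub>\<le>\<^sub>1 l. l \<in> lines P \<and> (p, l) \<in> inc P \<and> (q, l) \<in> inc P"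
    and at_most_one_point:
      "\<lbrakk>l \<in> lines P; m \<in> lines P; l \<noteq> m\<rbrakk> \<Longrightarrow>
         \<exists>\<^sub>\<le>\<^sub>1 p. p \<in> points P \<and> (p, l) \<in> inc P \<and> (p, m) \<in> inc P"

locale projective_plane = partial_plane +
  assumes exactly_one_line:
      "\<lbrakk>p \<in> points P; q \<in> points P; p \<noteq> q\<rbrakk> \<Longrightarrow>
         \<exists>!l. l \<in> lines P \<and> (p, l) \<in> inc P \<and> (q, l) \<in> inc P"
    and exactly_one_point:
      "\<lbrakk>l \<in> lines P; m \<in> lines P; l \<noteq> m\<rbrakk> \<Longrightarrow>
         \<exists>!p. p \<in> points P \<and> (p, l) \<in> inc P \<and> (p, m) \<in> inc P"
    and non_degenerate:
      "\<exists>S \<subseteq> points P. card S = 4 \<and> (\<forall>T \<subseteq> S. card T = 3 \<longrightarrow> \<not> collinear P T)"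

text \<open>
  The finite subconfigurations excluded by openness have to be nonempty: the empty one satisfies
  the degree condition vacuously.
\<close>

definition open_plane :: "('p, 'l) configuration \<Rightarrow> bool" where
  "open_plane P \<longleftrightarrow>
     \<not> (\<exists>A. subconfiguration A P \<and> finite (elements A) \<and> elements A \<noteq> {} \<and>
          (\<forall>x \<in> elements A. card {y \<in> elements A. incident A x y} \<ge> 3))"

text \<open>
  The relation \<open>r\<close> is the strict order. Finiteness is stated separately because \<open>card\<close> of an
  infinite set is 0.
\<close>

definition HF_ordering ::
  "('p, 'l) configuration \<Rightarrow> ('p, 'l) configuration \<Rightarrow> ('p + 'l) rel \<Rightarrow> bool" where
  "HF_ordering B A r \<longleftrightarrow>
     r \<subseteq> (elements B - elements A) \<times> (elements B - elements A) \<and>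
     strict_linear_order_on (elements B - elements A) r \<and>
     (\<forall>b \<in> elements B - elements A.
        let N = {x \<in> elements B. incident B b x \<and> (x \<in> elements A \<or> (x, b) \<in> r)}
        in finite N \<and> card N \<le> 2)"

definition HF_constructible_over ::
  "('p, 'l) configuration \<Rightarrow> ('p, 'l) configuration \<Rightarrow> bool" where
  "HF_constructible_over B A \<longleftrightarrow> subconfiguration A B \<and> (\<exists>r. HF_ordering B A r)"

end

theory Submission imports Defs begin

text \<open>
  The condition on an HF-ordering is universal: it says that no element has three distinct
  incident elements below it. Hence a compactness argument reduces the existence of an HF-ordering
  of an open plane to finite subsets of the plane. These are ordered by repeatedly splitting off,
  as the largest element, one that is incident with at most two of the others. Conversely, the
  largest element of a finite subconfiguration is incident with at most two of its elements.
\<close>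

section \<open>Compactness for strict linear orders avoiding finite patterns\<close>

lemma strict_linear_order_on_subset:
  "strict_linear_order_on A r \<Longrightarrow> B \<subseteq> A \<Longrightarrow> strict_linear_order_on B r"
  unfolding strict_linear_order_on_def by (blast intro: total_on_subset)

text \<open>Zorn's lemma is applied to relations that are compatible with a good order on every
  finite subset of \<open>E\<close>. A maximal one decides every pair, and each remaining property,
  including avoidance of a finite pattern, is checked on a finite set.\<close>

lemma strict_linear_order_compactness:
  fixes E :: "'a set" and T :: "'a rel set"
  assumes fin_T: "\<And>t. t \<in> T \<Longrightarrow> finite t"
    and fin_sat: "\<And>F. finite F \<Longrightarrow> F \<subseteq> E \<Longrightarrow>
      \<exists>s. strict_linear_order_on F s \<and> (\<forall>t\<in>T. \<not> t \<subseteq> s)"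
  shows "\<exists>r \<subseteq> E \<times> E. strict_linear_order_on E r \<and> (\<forall>t\<in>T. \<not> t \<subseteq> r)"
proof -
  \<comment> \<open>Members of \<open>Z\<close> need not be orders themselves. Only finite
    compatibility is demanded, which survives unions of chains.\<close>
  define extends where "extends = (\<lambda>r F s. strict_linear_order_on F s \<and>
    (\<forall>t\<in>T. \<not> t \<subseteq> s) \<and> r \<inter> F \<times> F \<subseteq> (s :: 'a rel))"
  define Z where "Z = {r. r \<subseteq> E \<times> E \<and> (\<forall>F. finite F \<longrightarrow> F \<subseteq> E \<longrightarrow> (\<exists>s. extends r F s))}"
  have "\<exists>M\<in>Z. \<forall>X\<in>Z. M \<subseteq> X \<longrightarrow> X = M"
  proof (rule subset_Zorn)
    fix C assume C: "subset.chain Z C"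
    have CZ: "C \<subseteq> Z" using C by (simp add: subset_chain_def)
    show "\<exists>U\<in>Z. \<forall>X\<in>C. X \<subseteq> U"
    proof (cases "C = {}")
      case True
      have "{} \<in> Z" using fin_sat by (auto simp: Z_def extends_def)
      with True show ?thesis by blast
    next
      case False
      have "\<exists>s. extends (\<Union>C) F s" if F: "finite F" "F \<subseteq> E" for F
      proof -
        \<comment> \<open>On \<open>F\<close> the union has only finitely many pairs, so a single
          member of the chain contains them all and its order on \<open>F\<close> serves for the
          union.\<close>
        have "finite (\<Union>C \<inter> F \<times> F)" using F by auto
        then obtain r where "r \<in> C" "\<Union>C \<inter> F \<times> F \<subseteq> r"
          using finite_subset_Union_chain[of "\<Union>C \<inter> F \<times> F" C Z] False C by auto
        moreover from this obtain s where "extends r F s"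
          using F CZ unfolding Z_def by blast
        ultimately show ?thesis by (intro exI[of _ s]) (auto simp: extends_def)
      qed
      then have "\<Union>C \<in> Z" using CZ unfolding Z_def by blast
      then show ?thesis by blast
    qed
  qed
  then obtain r where r: "r \<in> Z" and max: "\<And>r'. r' \<in> Z \<Longrightarrow> r \<subseteq> r' \<Longrightarrow> r' = r" by blast
  have rE: "r \<subseteq> E \<times> E"
    and ext: "\<And>F. finite F \<Longrightarrow> F \<subseteq> E \<Longrightarrow> \<exists>s. extends r F s"
    using r by (auto simp: Z_def)
  \<comment> \<open>Maximality in local form: a pair missing from \<open>r\<close> is missing
    because a finite set forbids it.\<close>
  have obstruct: "\<exists>F. finite F \<and> F \<subseteq> E \<and> (\<nexists>s. extends (insert (x, y) r) F s)"
    if "x \<in> E" "y \<in> E" "(x, y) \<notin> r" for x y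
    using max[of "insert (x, y) r"] that rE unfolding Z_def by blast
  have total: "total_on E r"
  proof (rule total_onI, rule ccontr)
    fix x y assume xy: "x \<in> E" "y \<in> E" "x \<noteq> y" and "\<not> ((x, y) \<in> r \<or> (y, x) \<in> r)"
    then obtain F G where F: "finite F" "F \<subseteq> E" "\<nexists>s. extends (insert (x, y) r) F s"
      and G: "finite G" "G \<subseteq> E" "\<nexists>s. extends (insert (y, x) r) G s"
      using obstruct by meson
    \<comment> \<open>\<open>H\<close> covers both obstructions and the undecided pair. An order on
      \<open>H\<close> puts \<open>x\<close> and \<open>y\<close> one way or the other and so
      refutes one obstruction. The same \<open>s\<close> serves for \<open>F\<close> and
      \<open>G\<close>, since \<open>strict_linear_order_on\<close> does not confine a relation to
      its set.\<close>
    define H where "H = insert x (insert y (F \<union> G))"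
    have "finite H" "H \<subseteq> E" using F G xy by (auto simp: H_def)
    then obtain s where s: "extends r H s" using ext by blast
    have "(x, y) \<in> s \<or> (y, x) \<in> s"
      using s xy unfolding extends_def strict_linear_order_on_def total_on_def H_def by blast
    moreover have "extends (insert (x, y) r) F s" if "(x, y) \<in> s"
      using s that strict_linear_order_on_subset[of H s F] by (auto simp: extends_def H_def)
    moreover have "extends (insert (y, x) r) G s" if "(y, x) \<in> s"
      using s that strict_linear_order_on_subset[of H s G] by (auto simp: extends_def H_def)
    ultimately show False using F(3) G(3) by blast
  qed
  have irrefl: "irrefl r"
  proof (rule irreflI)
    fix x show "(x, x) \<notin> r"
    proof
      assume x: "(x, x) \<in> r"
      with rE obtain s where "extends r {x} s" using ext[of "{x}"] by auto
      with x show False by (auto simp: extends_def strict_linear_order_on_def irrefl_def)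
    qed
  qed
  have "trans r"
  proof (rule transI)
    fix x y z assume xyz: "(x, y) \<in> r" "(y, z) \<in> r"
    then have E: "x \<in> E" "y \<in> E" "z \<in> E" using rE by auto
    then obtain s where s: "extends r {x, y, z} s" using ext[of "{x, y, z}"] by auto
    then have "(x, y) \<in> s" "(y, z) \<in> s" "irrefl s" "trans s"
      using xyz by (auto simp: extends_def strict_linear_order_on_def)
    \<comment> \<open>Compatibility only transfers pairs from \<open>r\<close> to \<open>s\<close>.
      Hence \<open>(x, z)\<close> is reached indirectly: \<open>s\<close> rules out
      \<open>(z, x)\<close>, and totality of \<open>r\<close> leaves \<open>(x, z)\<close>.\<close>
    then have "(x, z) \<in> s" "x \<noteq> z" "(z, x) \<notin> s" by (meson irreflD transD)+
    then have "(z, x) \<notin> r" using s by (auto simp: extends_def)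
    with \<open>x \<noteq> z\<close> E total show "(x, z) \<in> r" by (auto simp: total_on_def)
  qed
  moreover have "\<not> t \<subseteq> r" if t: "t \<in> T" for t
  proof
    assume "t \<subseteq> r"
    \<comment> \<open>The pattern involves only finitely many elements, so an order compatible with
      \<open>r\<close> on them would contain all of \<open>t\<close>.\<close>
    then have "finite (Field t)" "Field t \<subseteq> E"
      using fin_T[OF t] rE by (auto simp: finite_Field) (auto simp: Field_def)
    then obtain s where "extends r (Field t) s" using ext by blast
    moreover have "t \<subseteq> r \<inter> Field t \<times> Field t"
      using \<open>t \<subseteq> r\<close> by (auto simp: Field_def)
    ultimately show False
      using t unfolding extends_def by (meson subset_trans)
  qed
  ultimately show ?thesis
    using rE total irrefl by (intro exI[of _ r]) (auto simp: strict_linear_order_on_def)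
qed

section \<open>Degenerate orderings: from finite sets to arbitrary ones\<close>

lemma finite_degenerate_ordering:
  fixes R :: "'a \<Rightarrow> 'a \<Rightarrow> bool"
  assumes "finite F"
    and "\<And>G. G \<subseteq> F \<Longrightarrow> G \<noteq> {} \<Longrightarrow> \<exists>x\<in>G. card {y \<in> G. R x y} \<le> k"
  shows "\<exists>s \<subseteq> F \<times> F. strict_linear_order_on F s \<and>
    (\<forall>b S. S \<subseteq> Collect (R b) \<longrightarrow> card S = Suc k \<longrightarrow> \<not> S \<times> {b} \<subseteq> s)"
  using assms
proof (induction F rule: finite_psubset_induct)
  case (psubset F)
  show ?case
  proof (cases "F = {}")
    case True
    then show ?thesis
      by (intro exI[of _ "{}"]) (auto simp: strict_linear_order_on_def irrefl_def trans_def)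
  next
    case False
    with psubset.prems obtain x where x: "x \<in> F" "card {y \<in> F. R x y} \<le> k" by blast
    have "\<exists>s \<subseteq> (F - {x}) \<times> (F - {x}). strict_linear_order_on (F - {x}) s \<and>
      (\<forall>b S. S \<subseteq> Collect (R b) \<longrightarrow> card S = Suc k \<longrightarrow> \<not> S \<times> {b} \<subseteq> s)"
    proof (rule psubset.IH)
      show "F - {x} \<subset> F" using x(1) by blast
      fix G assume "G \<subseteq> F - {x}" "G \<noteq> {}"
      then show "\<exists>x\<in>G. card {y \<in> G. R x y} \<le> k" using psubset.prems[of G] by blast
    qed
    then obtain s where s: "s \<subseteq> (F - {x}) \<times> (F - {x})" "strict_linear_order_on (F - {x}) s"
      and avoid: "\<And>b S. S \<subseteq> Collect (R b) \<Longrightarrow> card S = Suc k \<Longrightarrow> \<not> S \<times> {b} \<subseteq> s"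
      by blast
    \<comment> \<open>The removed \<open>x\<close> is put on top. As \<open>s\<close> has no pair
      involving \<open>x\<close>, the result is still an order. All new pairs end in
      \<open>x\<close>, so a forbidden configuration below another element would already lie in
      \<open>s\<close>, while \<open>x\<close> has too few related elements in
      \<open>F\<close>.\<close>
    define s' where "s' = s \<union> (F - {x}) \<times> {x}"
    have "s' \<subseteq> F \<times> F" using s(1) x(1) by (auto simp: s'_def)
    moreover have "strict_linear_order_on F s'"
    proof -
      have "trans s" "irrefl s" "total_on (F - {x}) s"
        using s(2) by (auto simp: strict_linear_order_on_def)
      moreover have "trans s'"
      proof (rule transI)
        fix a b c assume "(a, b) \<in> s'" "(b, c) \<in> s'"
        then show "(a, c) \<in> s'"
          using s(1) transD[OF \<open>trans s\<close>, of a b c] by (auto simp: s'_def)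
      qed
      ultimately show ?thesis
        by (auto simp: strict_linear_order_on_def s'_def irrefl_def total_on_def)
    qed
    moreover have "\<not> S \<times> {b} \<subseteq> s'" if S: "S \<subseteq> Collect (R b)" "card S = Suc k" for b S
    proof
      assume sub: "S \<times> {b} \<subseteq> s'"
      show False
      proof (cases "b = x")
        case True
        then have "S \<subseteq> {y \<in> F. R x y}" using sub S s(1) by (auto simp: s'_def)
        then have "card S \<le> k"
          using x(2) card_mono[of "{y \<in> F. R x y}" S] psubset.hyps by simp
        then show False using S by simp
      next
        case False
        then show False using avoid[OF S] sub by (auto simp: s'_def)
      qed
    qed
    ultimately show ?thesis by (intro exI[of _ s'] conjI allI impI)
  qed
qed

text \<open>The hypothesis is \<open>k\<close>-degeneracy of all finite restrictions, as in graph
  theory. With incidence for \<open>R\<close> and \<open>k\<close> = 2, the ordering is an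
  HF-ordering over the empty configuration.\<close>

lemma degenerate_ordering:
  fixes R :: "'a \<Rightarrow> 'a \<Rightarrow> bool"
  assumes "\<And>F. finite F \<Longrightarrow> F \<subseteq> E \<Longrightarrow> F \<noteq> {} \<Longrightarrow> \<exists>x\<in>F. card {y \<in> F. R x y} \<le> k"
  shows "\<exists>r \<subseteq> E \<times> E. strict_linear_order_on E r \<and>
    (\<forall>b. finite {x. R b x \<and> (x, b) \<in> r} \<and> card {x. R b x \<and> (x, b) \<in> r} \<le> k)"
proof -
  \<comment> \<open>The bound \<open>k\<close> becomes a family of forbidden patterns:
    \<open>Suc k\<close> related elements below a common \<open>b\<close>. As \<open>Suc k\<close>
    is nonzero, \<open>card S = Suc k\<close> also makes \<open>S\<close> finite.\<close>
  define T where "T = {S \<times> {b} | S b. S \<subseteq> Collect (R b) \<and> card S = Suc k}"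
  have "finite t" if "t \<in> T" for t
    using that by (auto simp: T_def finite_cartesian_product_iff intro: card_ge_0_finite)
  moreover have "\<exists>s. strict_linear_order_on F s \<and> (\<forall>t\<in>T. \<not> t \<subseteq> s)"
    if F: "finite F" "F \<subseteq> E" for F
  proof -
    have "\<exists>x\<in>G. card {y \<in> G. R x y} \<le> k" if "G \<subseteq> F" "G \<noteq> {}" for G
      using assms that F finite_subset[of G F] by blast
    from finite_degenerate_ordering[OF F(1) this]
    obtain s where "strict_linear_order_on F s"
      "\<forall>b S. S \<subseteq> Collect (R b) \<longrightarrow> card S = Suc k \<longrightarrow> \<not> S \<times> {b} \<subseteq> s"
      by blast
    then show ?thesis by (intro exI[of _ s]) (auto simp: T_def)
  qed
  ultimately have "\<exists>r \<subseteq> E \<times> E. strict_linear_order_on E r \<and> (\<forall>t\<in>T. \<not> t \<subseteq> r)"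
    by (rule strict_linear_order_compactness)
  then obtain r where r: "r \<subseteq> E \<times> E" "strict_linear_order_on E r"
    and avoid: "\<And>t. t \<in> T \<Longrightarrow> \<not> t \<subseteq> r"
    by blast
  have no_subset: "card S \<noteq> Suc k" if "S \<subseteq> {x. R b x \<and> (x, b) \<in> r}" for S b
    using avoid[of "S \<times> {b}"] that unfolding T_def by blast
  \<comment> \<open>An infinite set would have a subset of \<open>Suc k\<close> elements. Its own
    \<open>card\<close> is 0, so the bound alone would not exclude it.\<close>
  have fin: "finite {x. R b x \<and> (x, b) \<in> r}" for b
    using infinite_arbitrarily_large[of "{x. R b x \<and> (x, b) \<in> r}" "Suc k"] no_subset[of _ b]
    by blast
  moreover have "card {x. R b x \<and> (x, b) \<in> r} \<le> k" for b
  proof (rule ccontr)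
    assume "\<not> ?thesis"
    then have "Suc k \<le> card {x. R b x \<and> (x, b) \<in> r}" by simp
    then obtain S where "S \<subseteq> {x. R b x \<and> (x, b) \<in> r}" "card S = Suc k"
      by (rule obtain_subset_with_card_n)
    with no_subset show False by blast
  qed
  ultimately show ?thesis using r by (intro exI[of _ r]) blast
qed

section \<open>Openness in terms of finite sets of elements\<close>

lemma elements_empty_configuration [simp]: "elements empty_configuration = {}"
  by (simp add: elements_def empty_configuration_def)

lemma subconfiguration_empty_configuration: "subconfiguration empty_configuration P"
  by (simp add: subconfiguration_def empty_configuration_def)

lemma elements_subconfiguration:
  "subconfiguration A P \<Longrightarrow> elements A \<subseteq> elements P"
  by (auto simp: subconfiguration_def elements_def)

lemma incident_subconfiguration:
  assumes "subconfiguration A P" "x \<in> elements A" "y \<in> elements A"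
  shows "incident A x y \<longleftrightarrow> incident P x y"
  using assms by (auto simp: subconfiguration_def elements_def incident_def)

lemma subset_eq_elements_subconfiguration:
  assumes "F \<subseteq> elements P"
  obtains A where "subconfiguration A P" "elements A = F"
proof
  let ?A = "\<lparr>points = Inl -` F, lines = Inr -` F, inc = inc P \<inter> (Inl -` F \<times> Inr -` F)\<rparr>"
  show "subconfiguration ?A P" using assms by (auto simp: subconfiguration_def elements_def)
  show "elements ?A = F" using assms by (auto simp: elements_def)
qed

text \<open>Incidence in a subconfiguration is induced, and every set of elements carries a
  subconfiguration. So configurations can be traded for bare sets, the form in which the ordering
  lemmas apply.\<close>

lemma open_plane_iff:
  "open_plane P \<longleftrightarrow> (\<forall>F. finite F \<longrightarrow> F \<subseteq> elements P \<longrightarrow> F \<noteq> {} \<longrightarrow>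
     (\<exists>x\<in>F. card {y \<in> F. incident P x y} \<le> 2))"
proof -
  have card_eq: "card {y \<in> elements A. incident A x y} = card {y \<in> elements A. incident P x y}"
    if "subconfiguration A P" "x \<in> elements A" for A x
    using incident_subconfiguration[OF that] by (metis (no_types, lifting))
  show ?thesis
  proof
    assume P: "open_plane P"
    show "\<forall>F. finite F \<longrightarrow> F \<subseteq> elements P \<longrightarrow> F \<noteq> {} \<longrightarrow>
      (\<exists>x\<in>F. card {y \<in> F. incident P x y} \<le> 2)"
    proof (intro allI impI)
      fix F assume F: "finite F" "F \<subseteq> elements P" "F \<noteq> {}"
      from F(2) obtain A where A: "subconfiguration A P" "elements A = F"
        by (rule subset_eq_elements_subconfiguration)
      with P F obtain x where "x \<in> F" "\<not> 3 \<le> card {y \<in> F. incident A x y}"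
        unfolding open_plane_def by blast
      with A card_eq[of A x] show "\<exists>x\<in>F. card {y \<in> F. incident P x y} \<le> 2"
        by (intro bexI[of _ x]) auto
    qed
  next
    assume P: "\<forall>F. finite F \<longrightarrow> F \<subseteq> elements P \<longrightarrow> F \<noteq> {} \<longrightarrow>
      (\<exists>x\<in>F. card {y \<in> F. incident P x y} \<le> 2)"
    have "\<exists>x \<in> elements A. \<not> 3 \<le> card {y \<in> elements A. incident A x y}"
      if A: "subconfiguration A P" "finite (elements A)" "elements A \<noteq> {}" for A
    proof -
      obtain x where "x \<in> elements A" "card {y \<in> elements A. incident P x y} \<le> 2"
        using P A elements_subconfiguration[OF A(1)] by blast
      with A card_eq[of A x] show ?thesis by (intro bexI[of _ x]) auto
    qed
    then show "open_plane P" unfolding open_plane_def by blast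
  qed
qed

section \<open>Largest elements and the equivalence of openness with HF-constructibility\<close>

lemma finite_strict_linear_order_greatest:
  assumes "finite F" "F \<noteq> {}" "strict_linear_order_on F r"
  obtains b where "b \<in> F" "\<And>x. x \<in> F \<Longrightarrow> x \<noteq> b \<Longrightarrow> (x, b) \<in> r"
proof -
  have "\<exists>b\<in>F. \<forall>x\<in>F. x \<noteq> b \<longrightarrow> (x, b) \<in> r"
    using assms
  proof (induction F rule: finite_ne_induct)
    case (singleton x)
    then show ?case by simp
  next
    case (insert x F)
    then obtain b where b: "b \<in> F" "\<forall>x\<in>F. x \<noteq> b \<longrightarrow> (x, b) \<in> r"
      using strict_linear_order_on_subset[OF insert.prems, of F] by blast
    with insert have "(x, b) \<in> r \<or> (b, x) \<in> r" and "trans r"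
      by (auto simp: strict_linear_order_on_def total_on_def)
    with b show ?case by (metis insert_iff transD)
  qed
  with that show thesis by blast
qed

theorem theorem1p2:
  fixes P :: "('p, 'l) configuration"
  assumes "projective_plane P"
  shows "open_plane P \<longleftrightarrow> HF_constructible_over P empty_configuration"
proof
  assume "open_plane P"
  then have "\<exists>x\<in>F. card {y \<in> F. incident P x y} \<le> 2"
    if "finite F" "F \<subseteq> elements P" "F \<noteq> {}" for F
    using that by (simp add: open_plane_iff)
  from degenerate_ordering[OF this] obtain r where r:
    "r \<subseteq> elements P \<times> elements P" "strict_linear_order_on (elements P) r"
    "\<forall>b. finite {x. incident P b x \<and> (x, b) \<in> r} \<and> card {x. incident P b x \<and> (x, b) \<in> r} \<le> 2"
    by blast
  have "{x \<in> elements P. incident P b x \<and> (x, b) \<in> r} = {x. incident P b x \<and> (x, b) \<in> r}" for b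
    using r(1) by blast
  with r have "HF_ordering P empty_configuration r"
    by (simp add: HF_ordering_def)
  then show "HF_constructible_over P empty_configuration"
    using subconfiguration_empty_configuration by (auto simp: HF_constructible_over_def)
next
  assume "HF_constructible_over P empty_configuration"
  then obtain r where r: "strict_linear_order_on (elements P) r"
    and N: "\<And>b. b \<in> elements P \<Longrightarrow> finite {x \<in> elements P. incident P b x \<and> (x, b) \<in> r}"
      "\<And>b. b \<in> elements P \<Longrightarrow> card {x \<in> elements P. incident P b x \<and> (x, b) \<in> r} \<le> 2"
    by (auto simp: HF_constructible_over_def HF_ordering_def Let_def)
  show "open_plane P"
    unfolding open_plane_iff
  proof (intro allI impI)
    fix F assume F: "finite F" "F \<subseteq> elements P" "F \<noteq> {}"
    obtain b where b: "b \<in> F" "\<And>x. x \<in> F \<Longrightarrow> x \<noteq> b \<Longrightarrow> (x, b) \<in> r"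
      using finite_strict_linear_order_greatest[OF F(1,3) strict_linear_order_on_subset[OF r F(2)]]
      by blast
    \<comment> \<open>Incidence only relates points to lines, so every element of \<open>F\<close>
      incident with \<open>b\<close> differs from \<open>b\<close> and hence lies below it.\<close>
    moreover have "\<not> incident P b b" by (auto simp: incident_def)
    ultimately have sub: "{y \<in> F. incident P b y}
      \<subseteq> {x \<in> elements P. incident P b x \<and> (x, b) \<in> r}"
      using F(2) by auto
    have "b \<in> elements P" using b(1) F(2) by blast
    from card_mono[OF N(1)[OF this] sub] N(2)[OF this]
    have "card {y \<in> F. incident P b y} \<le> 2" by (rule le_trans)
    with b(1) show "\<exists>x\<in>F. card {y \<in> F. incident P x y} \<le> 2" by blast
  qed
qed

end
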